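(* Let $\mathcal{E}_{\rm EVEN}=\mathcal{E}\cap K_{(2,2)}$ be the even part of the planar $3$-colorable subgroup $\mathcal{E}$ of Thompson's group $F$. For $i\in\mathbb{Z}_3$ let $Z_i=\{t\in(0,1)\cap\mathbb{Z}[1/2] : \tilde\omega(t)=i\}$. Then for every $j\in\mathbb{Z}_3$, $$\mathcal{E}_{\rm EVEN}=\bigcap_{i\in\mathbb{Z}_3}{\rm Stab}(Z_i)=\bigcap_{i\in\mathbb{Z}_3,\ i\neq j}{\rm Stab}(Z_i).$$
   Context: Thompson's group $F$ is the group of piecewise linear homeomorphisms of $[0,1]$ differentiable except at finitely many dyadic rationals, with all slopes powers of $2$; the product is $(f\cdot g)(t)=g(f(t))$. $K_{(2,2)}=\{f\in F: \log_2 f'(0)\in 2\mathbb{Z},\ \log_2 f'(1)\in 2\mathbb{Z}\}$. For a set $Z$ of dyadic rationals, ${\rm Stab}(Z)=\{f\in F: f(Z)=Z\}$. Tree diagrams: a tree diagram is a pair $(T_+,T_-)$ of finite planar rooted binary trees with the same number $n$ of leaves. Vertices are finite binary words (root = empty word, $v0$ and $v1$ = left and right child of $v$). It represents the element of $F$ sending $.\alpha_k\gamma$ to $.\beta_k\gamma$ for each $k$ and each infinite binary word $\gamma$, where $\alpha_k,\beta_k$ are the $k$-th leaves (from left to right) of $T_+,T_-$. Every element of $F$ is so represented, uniquely up to inserting/deleting pairs of opposing carets. One draws $T_-$ upside down below $T_+$ and identifies the $k$-th leaves of the two trees. Planar $3$-colorable subgroup $\mathcal{E}$: ignoring edges sprouting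 upward/downward from the two roots, the diagram partitions the plane into regions: the outer region $R_0=R_n$ and, for $1\le i\le n-1$, the region $R_i$ between the $i$-th and $(i+1)$-th leaves. If $v$ is a non-root vertex of $T_+$ or $T_-$ whose descendant leaves are numbers $p+1,\dots,q$, the edge from $v$ to its parent separates $R_p$ from $R_q$. $\mathcal{E}$ is the subgroup of elements whose plane partition is $3$-colorable: there is a map $c$ from the regions to $\mathbb{Z}_3$ giving different colors to regions sharing an edge, i.e. $c(R_p)\neq c(R_q)$ for each such $v$. This does not depend on the tree diagram chosen. The weight $\tilde\omega:\{0,1\}^*\to\mathbb{Z}_3$: draw the infinite rooted planar binary tree with root on top and color the regions of its complement by $\mathbb{Z}_3$ so that regions sharing an edge have different colors, the region above the root has color $0$ and the region directly below the root (between its two edges) has color $1$; this coloring is unique. For a vertex $v$ (a binary word), $\tilde\omega(v)$ is the color of the region to the left of $v$. Explicitly: assign to each vertex a pair (left color, right color); the root has $(0,0)$, its children $0$ and $1$ have $(0,1)$ and $(1,0)$; a non-root vertex with pair $(a,b)$, $a\ne b$, has children $v0,v1$ with pairs $(a,c)$ and $(c,b)$, where $c$ is the third color; $\tilde\omega(v)$ is the left color. One has $\tilde\omega(v0)=\tilde\omega(v)$, so $\tilde\omega(t):=\tilde\omega(a_1\ldots a_n)$ is well defined for a dyadic rational $t=.a_1\ldots a_n$ in $(0,1)$. *)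

theory Defs
  imports "HOL-Analysis.Analysis" "HOL-Library.Stream" "HOL-Library.Sublist"
    "HOL-Library.Numeral_Type"
begin

section \<open>Thompson's group F\<close>

definition dyadic :: "real set" where
  "dyadic = {x. \<exists>(a::int) (n::nat). x = of_int a / 2 ^ n}"

definition piecewise_linear :: "(real \<Rightarrow> real) \<Rightarrow> bool" where
  "piecewise_linear f \<longleftrightarrow>
    (\<exists>P. finite P \<and>
      (\<forall>a b. 0 \<le> a \<and> a < b \<and> b \<le> 1 \<and> {a<..<b} \<inter> P = {} \<longrightarrow>
        (\<exists>m c. \<forall>t\<in>{a..b}. f t = m * t + c)))"

text \<open>A self-map of the unit interval is encoded as a function that is \<open>undefined\<close> outside it,
  so that equality of elements of \<open>F\<close> is equality of functions.  All derivatives are taken within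
  the unit interval, hence one-sided at 0 and 1.\<close>

definition thompson_F :: "(real \<Rightarrow> real) set" where
  "thompson_F =
    {f \<in> extensional {0..1}.
      (\<exists>g. homeomorphism {0..1} {0..1} f g) \<and>
      piecewise_linear f \<and>
      (\<exists>S. finite S \<and> S \<subseteq> dyadic \<and>
        (\<forall>t\<in>{0..1} - S. \<exists>k::int. (f has_real_derivative 2 powi k) (at t within {0..1})))}"

definition even_slope_at :: "(real \<Rightarrow> real) \<Rightarrow> real \<Rightarrow> bool" where
  "even_slope_at f x \<longleftrightarrow>
    (\<exists>D. (f has_real_derivative D) (at x within {0..1}) \<and> (\<exists>m::int. log 2 D = of_int (2 * m)))"

definition K22 :: "(real \<Rightarrow> real) set" where
  "K22 = {f \<in> thompson_F. even_slope_at f 0 \<and> even_slope_at f 1}"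

definition Stab :: "real set \<Rightarrow> (real \<Rightarrow> real) set" where
  "Stab Z = {f \<in> thompson_F. f ` Z = Z}"

section \<open>Tree diagrams\<close>

text \<open>Binary words are lists of booleans, read from the root downwards; \<open>False\<close> is the digit 0
  (left child) and \<open>True\<close> the digit 1 (right child).\<close>

definition stream_value :: "bool stream \<Rightarrow> real" where
  "stream_value s = (\<Sum>n. of_bool (s !! n) / 2 ^ Suc n)"

definition word_value :: "bool list \<Rightarrow> real" where
  "word_value w = (\<Sum>n<length w. of_bool (w ! n) / 2 ^ Suc n)"

datatype bintree = Tip | Caret bintree bintree

primrec leaves :: "bintree \<Rightarrow> bool list list" where
  "leaves Tip = [[]]"
| "leaves (Caret l r) = map (Cons False) (leaves l) @ map (Cons True) (leaves r)"

definition vertices :: "bintree \<Rightarrow> bool list set" where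
  "vertices T = {v. \<exists>w\<in>set (leaves T). prefix v w}"

definition represents :: "bintree \<Rightarrow> bintree \<Rightarrow> (real \<Rightarrow> real) \<Rightarrow> bool" where
  "represents T1 T2 f \<longleftrightarrow>
    length (leaves T1) = length (leaves T2) \<and>
    (\<forall>k<length (leaves T1). \<forall>s::bool stream.
      f (stream_value (leaves T1 ! k @- s)) = stream_value (leaves T2 ! k @- s))"

section \<open>The planar 3-colorable subgroup\<close>

text \<open>Leaves are numbered from 1, hence the shift of the list index.\<close>

definition descendant_leaves :: "bintree \<Rightarrow> bool list \<Rightarrow> nat set" where
  "descendant_leaves T v = {k. 1 \<le> k \<and> k \<le> length (leaves T) \<and> prefix v (leaves T ! (k - 1))}"

text \<open>The color \<open>c p\<close> is that of the region \<open>R\<^sub>p\<close>; the numbers \<open>p < q\<close> with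
  \<open>descendant_leaves T v = {p + 1..q}\<close> exist and are unique for every vertex \<open>v\<close>.\<close>

definition separates_colors :: "bintree \<Rightarrow> (nat \<Rightarrow> 3) \<Rightarrow> bool" where
  "separates_colors T c \<longleftrightarrow>
    (\<forall>v\<in>vertices T. v \<noteq> [] \<longrightarrow>
      (\<forall>p q. p < q \<and> descendant_leaves T v = {p + 1..q} \<longrightarrow> c p \<noteq> c q))"

definition three_colorable :: "bintree \<Rightarrow> bintree \<Rightarrow> bool" where
  "three_colorable T1 T2 \<longleftrightarrow>
    (\<exists>c. c 0 = c (length (leaves T1)) \<and> separates_colors T1 c \<and> separates_colors T2 c)"

definition planar_E :: "(real \<Rightarrow> real) set" where
  "planar_E = {f \<in> thompson_F. \<exists>T1 T2. represents T1 T2 f \<and> three_colorable T1 T2}"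

definition planar_E_even :: "(real \<Rightarrow> real) set" where
  "planar_E_even = planar_E \<inter> K22"

section \<open>The weight\<close>

definition third_color :: "3 \<Rightarrow> 3 \<Rightarrow> 3" where
  "third_color a b = (THE c. c \<noteq> a \<and> c \<noteq> b)"

text \<open>The (left, right) colors of the vertex reached by the given word from a vertex with
  colors \<open>(a, b)\<close>.\<close>

primrec color_pair_from :: "3 \<Rightarrow> 3 \<Rightarrow> bool list \<Rightarrow> 3 \<times> 3" where
  "color_pair_from a b [] = (a, b)"
| "color_pair_from a b (x # w) =
    (if x then color_pair_from (third_color a b) b w else color_pair_from a (third_color a b) w)"

primrec color_pair :: "bool list \<Rightarrow> 3 \<times> 3" where
  "color_pair [] = (0, 0)"
| "color_pair (x # w) = (if x then color_pair_from 1 0 w else color_pair_from 0 1 w)"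

definition weight :: "bool list \<Rightarrow> 3" where
  "weight v = fst (color_pair v)"

text \<open>Finite binary expansions of a dyadic number differ only in trailing zeros, which do not
  change the weight.\<close>

definition dyadic_weight :: "real \<Rightarrow> 3" where
  "dyadic_weight t = (THE c. \<exists>w. word_value w = t \<and> weight w = c)"

definition weight_class :: "3 \<Rightarrow> real set" where
  "weight_class i = {t \<in> {0<..<1} \<inter> dyadic. dyadic_weight t = i}"

end

theory Submission
  imports Defs
begin

text \<open>
  Two trees with leaves \<open>\<alpha>\<^sub>k\<close> and \<open>\<beta>\<^sub>k\<close> admit a common coloring of the regions exactly when the pairs of
  colors on the two sides of \<open>\<alpha>\<^sub>k\<close> and \<open>\<beta>\<^sub>k\<close> agree up to one permutation of the colors.  Fixing the
  outer color, that permutation can only be the identity or the swap of the other two colors.  It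
  is visible at the first leaves \<open>0\<^sup>a\<close> and \<open>0\<^sup>b\<close>, whose right colors depend only on the parities of
  \<open>a\<close> and \<open>b\<close>, and \<open>2\<^sup>a\<^sup>-\<^sup>b\<close> is the slope at 0.  So even elements of \<open>\<E>\<close> preserve the weight;
  conversely the weights of the leaves of a weight-preserving element form a common coloring, and
  the weights of \<open>0\<^sup>a1\<close> and \<open>1\<^sup>a1\<close> record the parities of the slope exponents at 0 and 1.  Since
  elements of \<open>F\<close> permute the dyadic numbers of the open unit interval, preserving two weight
  classes forces preserving the third.
\<close>

section \<open>Binary expansions\<close>

lemma word_value_Nil [simp]: "word_value [] = 0"
  by (simp add: word_value_def)

lemma word_value_Cons [simp]: "word_value (b # w) = of_bool b / 2 + word_value w / 2"
  unfolding word_value_def length_Cons sum.lessThan_Suc_shift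
  by (simp add: sum_divide_distrib mult.commute)

lemma word_value_append: "word_value (v @ w) = word_value v + word_value w / 2 ^ length v"
  by (induction v) (simp_all add: field_simps)

lemma word_value_replicate_False [simp]: "word_value (replicate n False) = 0"
  by (induction n) simp_all

lemma word_value_replicate_True: "word_value (replicate n True) = 1 - 1 / 2 ^ n"
  by (induction n) (simp_all add: field_simps)

lemma word_value_nonneg: "0 \<le> word_value w"
  by (induction w) simp_all

lemma word_value_le: "word_value w + 1 / 2 ^ length w \<le> 1"
proof (induction w)
  case (Cons b w)
  have "word_value (b # w) + 1 / 2 ^ length (b # w) =
      of_bool b / 2 + (word_value w + 1 / 2 ^ length w) / 2"
    by (simp add: field_simps)
  then show ?case using Cons.IH by (cases b) auto
qed simp

lemma word_value_less_1: "word_value w < 1"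
  using word_value_le [of w] by (smt (verit) divide_pos_pos zero_less_power)

lemma word_value_dyadic: "word_value w \<in> dyadic"
proof -
  have "\<exists>a::int. word_value w = of_int a / 2 ^ length w"
  proof (induction w)
    case (Cons b w)
    then obtain a :: int where "word_value w = of_int a / 2 ^ length w" by blast
    then have "word_value (b # w) = of_int (a + of_bool b * 2 ^ length w) / 2 ^ length (b # w)"
      by (simp add: field_simps)
    then show ?case by blast
  qed (auto intro: exI [of _ 0])
  then show ?thesis by (auto simp: dyadic_def)
qed

lemma word_value_eqD:
  "length v = length w \<Longrightarrow> word_value v = word_value w \<Longrightarrow> v = w"
proof (induction v w rule: list_induct2)
  case (Cons a v b w)
  have "a = b"
    using Cons.prems word_value_less_1 [of v] word_value_less_1 [of w]
      word_value_nonneg [of v] word_value_nonneg [of w]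
    by (cases a; cases b) auto
  with Cons show ?case by simp
qed simp

lemma ex_word_value:
  "a < 2 ^ n \<Longrightarrow> \<exists>w. length w = n \<and> word_value w = real a / 2 ^ n"
proof (induction n arbitrary: a)
  case (Suc n)
  define b where "b = (2 ^ n \<le> a)"
  have "a - of_bool b * 2 ^ n < 2 ^ n" using Suc.prems by (auto simp: b_def)
  then obtain w where "length w = n" "word_value w = real (a - of_bool b * 2 ^ n) / 2 ^ n"
    using Suc.IH by blast
  then have "length (b # w) = Suc n \<and> word_value (b # w) = real a / 2 ^ Suc n"
    by (auto simp: b_def field_simps of_nat_diff)
  then show ?case by blast
qed simp

lemma ex_word_value_dyadic:
  assumes "t \<in> dyadic" "0 \<le> t" "t < 1"
  shows "\<exists>w. word_value w = t"
proof -
  obtain a :: int and n where t: "t = of_int a / 2 ^ n"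
    using assms(1) by (auto simp: dyadic_def)
  have "0 \<le> a" 
    using assms(2) zero_less_power [of "2::real" n] by (auto simp: t zero_le_divide_iff not_le [symmetric])
  have "real_of_int a < real_of_int (2 ^ n)" using assms(3) by (simp add: t)
  then have "a < 2 ^ n" by (simp only: of_int_less_iff)
  have "nat a < 2 ^ n"
    using \<open>0 \<le> a\<close> \<open>a < 2 ^ n\<close> by (simp add: nat_less_iff)
  then show ?thesis
    using ex_word_value [of "nat a" n] \<open>0 \<le> a\<close> by (auto simp: t)
qed

section \<open>Infinite binary expansions\<close>

lemma summable_stream_value: "summable (\<lambda>n. of_bool (s !! n) / 2 ^ Suc n :: real)"
proof (rule summable_comparison_test')
  show "summable (\<lambda>n. (1 / 2 :: real) ^ Suc n)"
    using power_half_series by (rule sums_summable)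
qed (auto simp: power_one_over)

lemma stream_value_SCons: "stream_value (b ## s) = of_bool b / 2 + stream_value s / 2"
proof -
  have "stream_value (b ## s) =
      of_bool b / 2 + (\<Sum>n. of_bool ((b ## s) !! Suc n) / 2 ^ Suc (Suc n))"
    unfolding stream_value_def
    using suminf_split_head [OF summable_stream_value [of "b ## s"]] by simp
  also have "(\<Sum>n. of_bool ((b ## s) !! Suc n) / 2 ^ Suc (Suc n)) =
      (\<Sum>n. of_bool (s !! n) / 2 ^ Suc n / 2 :: real)"
    by (simp add: mult.commute)
  also have "\<dots> = stream_value s / 2"
    unfolding stream_value_def by (rule suminf_divide [OF summable_stream_value])
  finally show ?thesis .
qed

lemma stream_value_shift: "stream_value (w @- s) = word_value w + stream_value s / 2 ^ length w"
  by (induction w) (simp_all add: stream_value_SCons field_simps)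

lemma stream_value_sconst_False [simp]: "stream_value (sconst False) = 0"
  by (simp add: stream_value_def)

lemma stream_value_bounds: "0 \<le> stream_value s" "stream_value s \<le> 1"
proof -
  show "0 \<le> stream_value s"
    unfolding stream_value_def by (intro suminf_nonneg summable_stream_value) auto
  have "stream_value s \<le> (\<Sum>n. (1 / 2) ^ Suc n)"
    unfolding stream_value_def
    by (intro suminf_le summable_stream_value sums_summable [OF power_half_series])
      (auto simp: power_one_over)
  then show "stream_value s \<le> 1"
    using sums_unique [OF power_half_series] by simp
qed

text \<open>After \<open>n\<close> digits both numbers lie in the same dyadic interval of length
  \<open>1 / 2 ^ n\<close>, so their distance is below every positive bound.\<close>

lemma stream_value_eq_lim:
  assumes "\<And>n. \<exists>r\<in>{0..1}. x = word_value (stake n s) + r / 2 ^ n"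
  shows "stream_value s = x"
proof (rule ccontr)
  assume "stream_value s \<noteq> x"
  then have "0 < \<bar>stream_value s - x\<bar>" by simp
  then obtain n where n: "(1 / 2) ^ n < \<bar>stream_value s - x\<bar>"
    using real_arch_pow_inv [of _ "1 / 2"] by force
  obtain r where r: "r \<in> {0..1}" "x = word_value (stake n s) + r / 2 ^ n"
    using assms by blast
  have "stream_value s = word_value (stake n s) + stream_value (sdrop n s) / 2 ^ n"
    using stream_value_shift [of "stake n s" "sdrop n s"] by (simp add: stake_sdrop)
  then have "\<bar>stream_value s - x\<bar> = \<bar>stream_value (sdrop n s) - r\<bar> / 2 ^ n"
    by (simp add: r(2) diff_divide_distrib [symmetric])
  also have "\<dots> \<le> 1 / 2 ^ n"
    using stream_value_bounds [of "sdrop n s"] r(1) by (intro divide_right_mono) auto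
  finally show False using n by (simp add: power_one_over)
qed

lemma ex_stream_value:
  assumes "x \<in> {0..1}"
  shows "\<exists>s. stream_value s = x"
proof -
  \<comment> \<open>\<open>T\<close> is the doubling map, and the digits of \<open>y\<close> record
    in which half of the interval each iterate lies. The choice at 1/2 makes \<open>T\<close> fix 1,
    so 1 gets the expansion consisting of ones only.\<close>
  define T :: "real \<Rightarrow> real" where "T y = (if 1 / 2 \<le> y then 2 * y - 1 else 2 * y)" for y
  define s where "s y = smap (\<lambda>z. 1 / 2 \<le> z) (siterate T y)" for y
  have "\<exists>r\<in>{0..1}. y = word_value (stake n (s y)) + r / 2 ^ n" if "y \<in> {0..1}" for n y
    using that
  proof (induction n arbitrary: y)
    case (Suc n)
    have "T y \<in> {0..1}" using Suc.prems by (auto simp: T_def)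
    then obtain r where r: "r \<in> {0..1}" "T y = word_value (stake n (s (T y))) + r / 2 ^ n"
      using Suc.IH by blast
    have "s y = (1 / 2 \<le> y) ## s (T y)"
      unfolding s_def by (subst siterate.code) simp
    moreover have "y = of_bool (1 / 2 \<le> y) / 2 + T y / 2"
      by (auto simp: T_def field_simps)
    ultimately have "y = word_value (stake (Suc n) (s y)) + r / 2 ^ Suc n"
      using r(2) by (simp add: add_divide_distrib)
    then show ?case using r(1) by blast
  qed auto
  then show ?thesis using stream_value_eq_lim assms by blast
qed

section \<open>Binary trees\<close>

lemma leaves_ne_Nil [simp]: "leaves T \<noteq> []"
  by (induction T) simp_all

lemma length_leaves_pos [simp]: "0 < length (leaves T)"
  by simp

lemma length_leaves_eq_1_iff: "length (leaves T) = 1 \<longleftrightarrow> T = Tip"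
  by (cases T) (auto simp: add_is_1)

lemma first_leaf: "\<exists>a. leaves T ! 0 = replicate a False"
proof (induction T)
  case (Caret l r)
  then show ?case
    by (auto simp: nth_append intro: exI [of _ "Suc _"])
qed (auto intro: exI [of _ 0])

lemma last_leaf: "\<exists>a. leaves T ! (length (leaves T) - 1) = replicate a True"
proof -
  have "\<exists>a. last (leaves T) = replicate a True"
  proof (induction T)
    case (Caret l r)
    then show ?case by (auto simp: last_map intro: exI [of _ "Suc _"])
  qed (auto intro: exI [of _ 0])
  then show ?thesis by (simp add: last_conv_nth)
qed

lemma leaf_Nil_iff: "k < length (leaves T) \<Longrightarrow> leaves T ! k = [] \<longleftrightarrow> T = Tip"
  by (cases T) (auto simp: nth_append)

text \<open>Following any sufficiently long word down the tree passes through a leaf. Padding with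
  zeros makes the word long enough without changing its value or its weight.\<close>

lemma leaf_prefix_of_padded_word:
  "\<exists>k<length (leaves T). \<exists>u m. w @ replicate m False = leaves T ! k @ u"
proof (induction T arbitrary: w)
  case (Caret l r)
  show ?case
  proof (cases "w \<noteq> [] \<and> hd w")
    case True
    then obtain w' where w: "w = True # w'" by (cases w) auto
    obtain k u m where "k < length (leaves r)" "w' @ replicate m False = leaves r ! k @ u"
      using Caret.IH(2) by blast
    then show ?thesis
      by (intro exI [of _ "length (leaves l) + k"] conjI exI [of _ u] exI [of _ m])
        (auto simp: w nth_append)
  next
    case False
    obtain k u m where *: "k < length (leaves l)" "tl w @ replicate m False = leaves l ! k @ u"
      using Caret.IH(1) by blast
    \<comment> \<open>The empty word supplies no digit for the step to the left child, so one more
      zero is spent on it.\<close>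
    have "w @ replicate (if w = [] then Suc m else m) False = False # tl w @ replicate m False"
      using False by (cases w) auto
    then show ?thesis using *
      by (intro exI [of _ k] conjI exI [of _ u] exI [of _ "if w = [] then Suc m else m"])
        (auto simp: nth_append)
  qed
qed auto

lemma dyadic_eq_leaf_value:
  assumes "t \<in> dyadic" "0 \<le> t" "t < 1"
  shows "\<exists>k<length (leaves T). \<exists>u. t = word_value (leaves T ! k @ u)"
proof -
  obtain w where w: "word_value w = t" using ex_word_value_dyadic assms by blast
  obtain k u m where k: "k < length (leaves T)" "w @ replicate m False = leaves T ! k @ u"
    using leaf_prefix_of_padded_word by blast
  have "t = word_value (w @ replicate m False)" by (simp add: word_value_append w)
  with k show ?thesis by auto
qed

text \<open>The standard dyadic intervals of the words in the list cover the interval from \<open>a\<close> to \<open>b\<close>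
  from left to right without gaps or overlaps.\<close>

fun tiles :: "real \<Rightarrow> bool list list \<Rightarrow> real \<Rightarrow> bool" where
  "tiles a [] b \<longleftrightarrow> a = b"
| "tiles a (w # ws) b \<longleftrightarrow> word_value w = a \<and> tiles (a + 1 / 2 ^ length w) ws b"

lemma tiles_append: "tiles a (us @ vs) b \<longleftrightarrow> (\<exists>c. tiles a us c \<and> tiles c vs b)"
  by (induction us arbitrary: a) auto

lemma tiles_le: "tiles a ws b \<Longrightarrow> a \<le> b"
proof (induction ws arbitrary: a)
  case (Cons w ws)
  then have "a + 1 / 2 ^ length w \<le> b" by auto
  moreover have "0 < (1 / 2 ^ length w :: real)" by simp
  ultimately show ?case by linarith
qed simp

text \<open>Prepending the digit \<open>x\<close> acts on values as t -> (t + x) / 2; the endpoints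
  on the right-hand side undo this map.\<close>

lemma tiles_map_Cons:
  "tiles a (map (Cons x) ws) b \<longleftrightarrow> tiles (2 * a - of_bool x) ws (2 * b - of_bool x)"
  by (induction ws arbitrary: a) (auto simp: algebra_simps)

lemma tiles_map_upt:
  assumes "a \<le> n" "\<And>i. a \<le> i \<Longrightarrow> i < n \<Longrightarrow>
      word_value (w i) = g i \<and> g i + 1 / 2 ^ length (w i) = g (Suc i)"
  shows "tiles (g a) (map w [a..<n]) (g n)"
  using assms by (induction rule: inc_induct) (simp_all add: upt_conv_Cons)

text \<open>The words of a tiling have increasing values, and words starting with 0 have values
  below 1/2, so none of them can follow a word starting with 1.\<close>

lemma tiles_split:
  assumes "tiles a ws b" "[] \<notin> set ws"
  shows "\<exists>us vs. ws = map (Cons False) us @ map (Cons True) vs"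
  using assms
proof (induction ws arbitrary: a)
  case (Cons w ws)
  then obtain us vs where ws: "ws = map (Cons False) us @ map (Cons True) vs" by force
  from Cons.prems obtain x w' where w: "w = x # w'" by (cases w) auto
  show ?case
  proof (cases x)
    case False
    then have "w # ws = map (Cons False) (w' # us) @ map (Cons True) vs"
      by (simp add: w ws)
    then show ?thesis by blast
  next
    case True
    have "us = []"
    proof (rule ccontr)
      assume "us \<noteq> []"
      then obtain u us' where us: "us = u # us'" by (cases us) auto
      \<comment> \<open>The next tile begins where \<open>w\<close> ends, hence beyond 1/2, although
        its word starts with 0.\<close>
      have "word_value u / 2 = 1 / 2 + word_value w' / 2 + 1 / 2 ^ length w"
        using Cons.prems True by (simp add: ws us w)
      moreover have "0 < (1 / 2 ^ length w :: real)" by simp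
      ultimately show False
        using word_value_less_1 [of u] word_value_nonneg [of w'] by linarith
    qed
    then have "w # ws = map (Cons False) [] @ map (Cons True) (w' # vs)"
      using True by (simp add: w ws)
    then show ?thesis by blast
  qed
qed (auto intro: exI [of _ "[]"])

lemma tiles_within:
  assumes "tiles a ws b" "w \<in> set ws"
  shows "a \<le> word_value w \<and> word_value w + 1 / 2 ^ length w \<le> b"
  using assms
proof (induction ws arbitrary: a)
  case (Cons v ws)
  have pos: "0 < (1 / 2 ^ length v :: real)" by simp
  have ws: "tiles (a + 1 / 2 ^ length v) ws b" "word_value v = a" using Cons.prems by auto
  show ?case
  proof (cases "w \<in> set ws")
    case True
    then show ?thesis using Cons.IH [OF ws(1)] pos by linarith
  next
    case False
    then show ?thesis using Cons.prems(2) tiles_le [OF ws(1)] ws(2) by auto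
  qed
qed simp

text \<open>Converts a subdivision into standard dyadic intervals into a tree. Either the empty word
  fills the whole interval, or the tiling breaks at 1/2 and each half, rescaled, is a tiling with
  smaller total word length.\<close>

lemma tiles_imp_leaves:
  "tiles 0 ws 1 \<Longrightarrow> \<exists>T. leaves T = ws"
proof (induction "sum_list (map length ws)" arbitrary: ws rule: less_induct)
  case less
  show ?case
  proof (cases "[] \<in> set ws")
    case True
    then obtain us vs where ws: "ws = us @ [] # vs" by (meson split_list)
    then obtain "tiles 0 us 0" "tiles 1 vs 1"
      using less.prems by (auto simp: tiles_append)
    \<comment> \<open>Every tile has positive length, so an interval of length 0 has only the empty
      tiling. This leaves no room on either side of the empty word.\<close>
    moreover have "ws' = []" if "tiles c ws' c" for ws' c
    proof (rule ccontr)
      assume "ws' \<noteq> []"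
      then have "hd ws' \<in> set ws'" by simp
      from tiles_within [OF that this] have "1 / 2 ^ length (hd ws') \<le> (0::real)" by linarith
      moreover have "0 < (1 / 2 ^ length (hd ws') :: real)" by simp
      ultimately show False by linarith
    qed
    ultimately have "us = []" "vs = []" by blast+
    then have "leaves Tip = ws" by (simp add: ws)
    then show ?thesis by blast
  next
    case False
    obtain us vs where ws: "ws = map (Cons False) us @ map (Cons True) vs"
      using tiles_split [OF less.prems False] by blast
    obtain c where c: "tiles 0 (map (Cons False) us) c" "tiles c (map (Cons True) vs) 1"
      using less.prems by (auto simp: ws tiles_append)
    \<comment> \<open>The last tile from the left half ends at or before 1/2, and the first tile
      from the right half begins at or after it.\<close>
    have "c \<le> 1 / 2"
    proof (cases us rule: rev_cases)
      case (snoc us' u)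
      then show ?thesis
        using c(1) word_value_le [of u] by (auto simp: tiles_append)
    qed (use c(1) in auto)
    moreover have "1 / 2 \<le> c"
    proof (cases vs)
      case (Cons v vs')
      then show ?thesis using c(2) word_value_nonneg [of v] by auto
    qed (use c(2) in auto)
    ultimately have c_eq: "c = 1 / 2" by simp
    have us: "tiles 0 us 1" and vs: "tiles 0 vs 1"
      using c by (auto simp: tiles_map_Cons c_eq)
    then have "us \<noteq> []" "vs \<noteq> []" by auto
    have len: "sum_list (map (length \<circ> Cons x) xs) = length xs + sum_list (map length xs)"
      for x :: bool and xs
      by (induction xs) auto
    obtain l where "leaves l = us"
      using less.hyps [OF _ us] \<open>us \<noteq> []\<close> by (auto simp: ws len)
    moreover obtain r where "leaves r = vs"
      using less.hyps [OF _ vs] \<open>vs \<noteq> []\<close> by (auto simp: ws len)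
    ultimately have "leaves (Caret l r) = ws" by (simp add: ws)
    then show ?thesis by blast
  qed
qed

section \<open>Tree diagrams of elements of F\<close>

text \<open>The base-2 logarithm of the difference quotient at \<open>a\<close> is continuous and, by the mean value
  theorem, integer-valued, hence constant.\<close>

lemma power_two_slope_imp_affine:
  fixes f :: "real \<Rightarrow> real"
  assumes "a < b" and cont: "continuous_on {a..b} f"
    and deriv: "\<And>t. a < t \<Longrightarrow> t < b \<Longrightarrow> \<exists>k::int. (f has_real_derivative 2 powi k) (at t)"
  shows "\<exists>k::int. \<forall>t\<in>{a..b}. f t = f a + 2 powi k * (t - a)"
proof -
  define h where "h t = log 2 ((f t - f a) / (t - a))" for t
  have h: "\<exists>k::int. f t - f a = 2 powi k * (t - a) \<and> h t = of_int k" if "a < t" "t \<le> b" for t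
  proof -
    have "\<exists>l z. a < z \<and> z < t \<and> DERIV f z :> l \<and> f t - f a = (t - a) * l"
      using that deriv
      by (intro MVT continuous_on_subset [OF cont]) (auto simp: real_differentiable_def, force)
    then obtain l z where "a < z" "z < t" "DERIV f z :> l" "f t - f a = (t - a) * l"
      by blast
    moreover obtain k :: int where "DERIV f z :> 2 powi k"
      using deriv [of z] \<open>a < z\<close> \<open>z < t\<close> \<open>t \<le> b\<close> by auto
    ultimately have k: "f t - f a = 2 powi k * (t - a)"
      by (auto dest: DERIV_unique)
    then have "h t = log 2 (2 powi k)" using that by (simp add: h_def)
    also have "\<dots> = of_int k" by (simp flip: powr_real_of_int')
    finally show ?thesis using k by blast
  qed
  have "h constant_on {a<..b}"
  proof (rule continuous_discrete_range_constant)
    show "continuous_on {a<..b} h"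
    proof -
      have "continuous_on {a<..b} f" by (rule continuous_on_subset [OF cont]) auto
      then have "continuous_on {a<..b} (\<lambda>t. (f t - f a) / (t - a))"
        by (intro continuous_intros) auto
      moreover have "(f t - f a) / (t - a) \<noteq> 0" if t: "t \<in> {a<..b}" for t
      proof -
        obtain k :: int where "f t - f a = 2 powi k * (t - a)" using t h by auto
        then show ?thesis using t by simp
      qed
      ultimately have "continuous_on {a<..b} (\<lambda>t. ln ((f t - f a) / (t - a)))"
        by (intro continuous_on_ln) auto
      then have "continuous_on {a<..b} (\<lambda>t. ln ((f t - f a) / (t - a)) / ln 2)"
        by (rule continuous_on_divide) (auto intro: continuous_on_const)
      then show ?thesis by (simp add: h_def log_def)
    qed
    fix t assume t: "t \<in> {a<..b}"
    show "\<exists>e>0. \<forall>s. s \<in> {a<..b} \<and> h s \<noteq> h t \<longrightarrow> e \<le> norm (h s - h t)"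
    proof (intro exI [of _ 1] conjI allI impI)
      fix s assume s: "s \<in> {a<..b} \<and> h s \<noteq> h t"
      obtain k l :: int where "h t = of_int k" "h s = of_int l"
        using h t s by (metis greaterThanAtMost_iff)
      moreover from this have "1 \<le> \<bar>l - k\<bar>" using s by auto
      then have "real_of_int 1 \<le> of_int \<bar>l - k\<bar>" by (simp only: of_int_le_iff)
      ultimately show "1 \<le> norm (h s - h t)" by simp
    qed auto
  qed auto
  then obtain c where c: "h t = c" if "t \<in> {a<..b}" for t
    by (auto simp: constant_on_def)
  obtain k :: int where k: "c = of_int k"
    using h [of b] c [of b] \<open>a < b\<close> by auto
  have "f t = f a + 2 powi k * (t - a)" if t: "t \<in> {a..b}" for t
  proof (cases "t = a")
    case False
    then have t': "a < t" "t \<le> b" using t by auto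
    then obtain m :: int where m: "f t - f a = 2 powi m * (t - a)" "h t = of_int m"
      using h by blast
    then have "m = k" using c [of t] t' k by simp
    with m show ?thesis by simp
  qed simp
  then show ?thesis by blast
qed

section \<open>Dyadic subdivisions on which an element of F is affine\<close>

lemma thompson_F_range:
  assumes "f \<in> thompson_F" "t \<in> {0..1}"
  shows "f t \<in> {0..1}"
  using assms by (auto simp: thompson_F_def homeomorphism_def)

lemma thompson_F_inj: "f \<in> thompson_F \<Longrightarrow> inj_on f {0..1}"
  by (auto simp: thompson_F_def homeomorphism_def) (metis inj_on_inverseI)

text \<open>Stated for all large \<open>n\<close> because it is later applied with an exponent that
  varies from piece to piece.\<close>

lemma common_denominator:
  assumes "finite S" "S \<subseteq> dyadic"
  shows "\<exists>N. \<forall>n\<ge>N. \<forall>s\<in>S. s * 2 ^ n \<in> \<int>"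
proof -
  have "\<exists>N. \<forall>n\<ge>N. s * 2 ^ n \<in> \<int>" if s: "s \<in> S" for s
  proof -
    obtain a :: int and m where s: "s = of_int a / 2 ^ m"
      using s assms(2) by (auto simp: dyadic_def)
    have "s * 2 ^ n = of_int (a * 2 ^ (n - m))" if "m \<le> n" for n
      using that by (simp add: s field_simps flip: power_add)
    then show ?thesis by (metis Ints_of_int)
  qed
  then obtain N where N: "\<And>s n. s \<in> S \<Longrightarrow> N s \<le> n \<Longrightarrow> s * 2 ^ n \<in> \<int>" by metis
  have "s * 2 ^ n \<in> \<int>" if "Max (insert 0 (N ` S)) \<le> n" "s \<in> S" for s n
    using that assms(1) by (intro N) auto
  then show ?thesis by blast
qed

text \<open>On a dyadic grid fine enough to contain all breakpoints, no breakpoint is interior to a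
  cell, so \<open>power_two_slope_imp_affine\<close> applies on each cell.\<close>

lemma thompson_F_affine_pieces:
  assumes "f \<in> thompson_F"
  shows "\<exists>N. \<forall>j<2 ^ N. \<exists>k::int. \<forall>t\<in>{real j / 2 ^ N..real (Suc j) / 2 ^ N}.
    f t = f (real j / 2 ^ N) + 2 powi k * (t - real j / 2 ^ N)"
proof -
  obtain S where S: "finite S" "S \<subseteq> dyadic"
    and deriv: "\<And>t. t \<in> {0..1} - S \<Longrightarrow> \<exists>k::int. (f has_real_derivative 2 powi k) (at t within {0..1})"
    and cont: "continuous_on {0..1} f"
    using assms unfolding thompson_F_def homeomorphism_def mem_Collect_eq by (elim conjE exE) metis
  obtain N where N: "\<And>s. s \<in> S \<Longrightarrow> s * 2 ^ N \<in> \<int>"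
    using common_denominator [OF S] by blast
  have "\<exists>k::int. \<forall>t\<in>{real j / 2 ^ N..real (Suc j) / 2 ^ N}.
    f t = f (real j / 2 ^ N) + 2 powi k * (t - real j / 2 ^ N)" if j: "j < 2 ^ N" for j
  proof (rule power_two_slope_imp_affine)
    have "real (Suc j) \<le> real (2 ^ N)" using j by (simp only: of_nat_le_iff Suc_le_eq)
    then have le1: "real (Suc j) / 2 ^ N \<le> 1" by simp
    have ge0: "0 \<le> real j / 2 ^ N" by simp
    show "continuous_on {real j / 2 ^ N..real (Suc j) / 2 ^ N} f"
      using le1 ge0 by (intro continuous_on_subset [OF cont]) (auto intro: order_trans)
    fix t assume t: "real j / 2 ^ N < t" "t < real (Suc j) / 2 ^ N"
    have "t \<notin> S"
    proof
      assume "t \<in> S"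
      then obtain a :: int where a: "t * 2 ^ N = of_int a" using N by (metis Ints_cases)
      have "real_of_int (int j) < of_int a" "real_of_int a < of_int (int (Suc j))"
        using t by (simp_all add: field_simps flip: a)
      then show False by (simp only: of_int_less_iff)
    qed
    moreover have "t \<in> {0<..<1}" using t ge0 le1 by (simp only: greaterThanLessThan_iff) linarith
    ultimately show "\<exists>k::int. (f has_real_derivative 2 powi k) (at t)"
      using deriv [of t] at_within_Icc_at [of 0 t 1] by auto
  qed (simp add: divide_strict_right_mono)
  then show ?thesis by blast
qed

text \<open>All slopes are positive, so \<open>f\<close> takes its extreme values at 0 and 1, and
  surjectivity forces these to be 0 and 1. The values at grid points are then sums of increments of
  the form 2 to an integer power.\<close>

lemma thompson_F_grid:
  assumes f: "f \<in> thompson_F"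
    and pieces: "\<And>j. j < 2 ^ N \<Longrightarrow> \<forall>t\<in>{real j / 2 ^ N..real (Suc j) / 2 ^ N}.
      f t = f (real j / 2 ^ N) + 2 powi (k j :: int) * (t - real j / 2 ^ N)"
  shows "f 0 = 0" "f 1 = 1" "\<And>j. j \<le> 2 ^ N \<Longrightarrow> f (real j / 2 ^ N) \<in> dyadic"
proof -
  let ?g = "\<lambda>j. f (real j / 2 ^ N)"
  have incr: "?g (Suc j) = ?g j + 2 powi k j / 2 ^ N" if "j < 2 ^ N" for j
  proof -
    have "real (Suc j) / 2 ^ N \<in> {real j / 2 ^ N..real (Suc j) / 2 ^ N}"
      by (simp add: divide_right_mono)
    then have "?g (Suc j) = ?g j + 2 powi k j * (real (Suc j) / 2 ^ N - real j / 2 ^ N)"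
      using pieces that by blast
    then show ?thesis by (simp flip: diff_divide_distrib)
  qed
  have mono: "?g i \<le> ?g j" if "i \<le> j" "j \<le> 2 ^ N" for i j
    using that
  proof (induction rule: dec_induct)
    case (step n)
    have "?g n \<le> ?g (Suc n)" using step.hyps step.prems incr [of n] by simp
    with step show ?case by simp
  qed simp
  have between: "f 0 \<le> f t \<and> f t \<le> f 1" if t: "t \<in> {0..1}" for t
  proof (cases "t = 1")
    case True
    then show ?thesis using mono [of 0 "2 ^ N"] by simp
  next
    case False
    \<comment> \<open>The index of the grid cell containing \<open>t\<close>. The case
      \<open>t = 1\<close> was split off because the floor would give \<open>2 ^ N\<close>, which is
      no cell.\<close>
    define j where "j = nat \<lfloor>t * 2 ^ N\<rfloor>"
    have j_le: "real j \<le> t * 2 ^ N" "t * 2 ^ N < real (Suc j)"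
      using t by (auto simp: j_def) linarith
    have "t < 1" using t False by auto
    then have "t * 2 ^ N < 2 ^ N" by simp
    then have "real j < 2 ^ N" using j_le(1) by linarith
    then have "real j < real (2 ^ N)" by simp
    then have j: "j < 2 ^ N" by (simp only: of_nat_less_iff)
    have t_in: "real j / 2 ^ N \<le> t" "t \<le> real (Suc j) / 2 ^ N"
      using j_le by (simp_all add: field_simps)
    have ft: "f t = ?g j + 2 powi k j * (t - real j / 2 ^ N)"
      using bspec [OF pieces [OF j], of t] t_in by simp
    have "f 0 \<le> ?g j" using mono [of 0 j] j by simp
    moreover have "?g j \<le> f t" using ft t_in by simp
    moreover have "f t \<le> ?g (Suc j)"
    proof -
      have "2 powi k j * (t - real j / 2 ^ N) \<le> 2 powi k j * (1 / 2 ^ N)"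
        using t_in(2) by (intro mult_left_mono) (simp_all add: add_divide_distrib)
      then show ?thesis using ft incr [OF j] by simp
    qed
    moreover have "?g (Suc j) \<le> f 1" using mono [of "Suc j" "2 ^ N"] j by simp
    ultimately show ?thesis by linarith
  qed
  have surj: "f ` {0..1} = {0..1}"
    using f by (auto simp: thompson_F_def homeomorphism_def)
  have "(0::real) \<in> f ` {0..1}" "(1::real) \<in> f ` {0..1}" unfolding surj by auto
  then obtain x y where "x \<in> {0..1}" "f x = 0" "y \<in> {0..1}" "f y = 1" by (metis imageE)
  then show f0: "f 0 = 0" and "f 1 = 1"
    using between [of x] between [of y] thompson_F_range [OF f, of 0] thompson_F_range [OF f, of 1]
    by auto
  fix j :: nat
  assume "j \<le> 2 ^ N"
  then show "?g j \<in> dyadic"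
  proof (induction j)
    case 0
    have "(0::real) = of_int 0 / 2 ^ 0" by simp
    then show ?case using f0 unfolding dyadic_def by auto
  next
    case (Suc j)
    have "(2::real) powi k j / 2 ^ N \<in> dyadic"
    proof (cases "0 \<le> k j")
      case True
      then have "(2::real) powi k j / 2 ^ N = of_int (2 ^ nat (k j)) / 2 ^ N"
        by (simp add: power_int_def)
      then show ?thesis unfolding dyadic_def by blast
    next
      case False
      then have "(2::real) powi k j / 2 ^ N = of_int 1 / 2 ^ (nat (- k j) + N)"
        by (simp add: power_int_def power_add field_simps)
      then show ?thesis unfolding dyadic_def by blast
    qed
    then obtain a b :: int and m n where
      "?g j = of_int a / 2 ^ m" "(2::real) powi k j / 2 ^ N = of_int b / 2 ^ n"
      using Suc by (auto simp: dyadic_def)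
    then have "?g (Suc j) = of_int (a * 2 ^ n + b * 2 ^ m) / 2 ^ (m + n)"
      using incr [of j] Suc.prems
      by (simp del: of_nat_Suc add: add_divide_distrib power_add)
    then show ?case unfolding dyadic_def by blast
  qed
qed

text \<open>Refines the grid until every cell is mapped affinely onto a standard dyadic interval.
  For this the image length must be \<open>1 / 2 ^ L\<close> with \<open>L\<close> a natural number,
  and the left end of the image a multiple of that length.\<close>

lemma thompson_F_cells:
  assumes f: "f \<in> thompson_F"
  shows "\<exists>N. \<forall>i<2 ^ N. \<exists>w. \<forall>x\<in>{0..1}. f ((real i + x) / 2 ^ N) = word_value w + x / 2 ^ length w"
proof -
  obtain N\<^sub>0 and k :: "nat \<Rightarrow> int" where pieces: "\<And>j. j < 2 ^ N\<^sub>0 \<Longrightarrow>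
      \<forall>t\<in>{real j / 2 ^ N\<^sub>0..real (Suc j) / 2 ^ N\<^sub>0}.
        f t = f (real j / 2 ^ N\<^sub>0) + 2 powi k j * (t - real j / 2 ^ N\<^sub>0)"
    using thompson_F_affine_pieces [OF f] by metis
  let ?g = "\<lambda>j. f (real j / 2 ^ N\<^sub>0)"
  have "?g ` {..<2 ^ N\<^sub>0} \<subseteq> dyadic"
    using thompson_F_grid(3) [OF f pieces] by auto
  then obtain N\<^sub>1 where N\<^sub>1: "\<And>n j. N\<^sub>1 \<le> n \<Longrightarrow> j < 2 ^ N\<^sub>0 \<Longrightarrow> ?g j * 2 ^ n \<in> \<int>"
    using common_denominator [of "?g ` {..<2 ^ N\<^sub>0}"] by auto
  define K where "K = Max ((\<lambda>j. nat \<bar>k j\<bar>) ` {..<2 ^ N\<^sub>0})"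
  have K: "\<bar>k j\<bar> \<le> int K" if "j < 2 ^ N\<^sub>0" for j
  proof -
    have "nat \<bar>k j\<bar> \<le> K" unfolding K_def using that by (intro Max_ge) auto
    then show ?thesis by linarith
  qed
  \<comment> \<open>\<open>K\<close> compensates for the steepest slope, so that image cells have
    length at most \<open>1 / 2 ^ N\<^sub>1\<close>; \<open>N\<^sub>1\<close> makes the values at
    the coarse grid points multiples of that length.\<close>
  define N where "N = N\<^sub>0 + (N\<^sub>1 + K)"
  have "\<exists>w. \<forall>x\<in>{0..1}. f ((real i + x) / 2 ^ N) = word_value w + x / 2 ^ length w"
    if i: "i < 2 ^ N" for i
  proof -
    \<comment> \<open>Fine cell \<open>i\<close> is the \<open>r\<close>-th subcell, counted from 0,
      of the coarse cell \<open>j\<close>.\<close>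
    define j r where "j = i div 2 ^ (N\<^sub>1 + K)" and "r = i mod 2 ^ (N\<^sub>1 + K)"
    have j: "j < 2 ^ N\<^sub>0"
      using i unfolding j_def N_def by (simp add: less_mult_imp_div_less power_add)
    have i_eq: "i = j * 2 ^ (N\<^sub>1 + K) + r" unfolding j_def r_def by (rule div_mult_mod_eq [symmetric])
    have "r < 2 ^ (N\<^sub>1 + K)" by (simp add: r_def)
    then have "real (Suc r) \<le> real (2 ^ (N\<^sub>1 + K))" by (simp only: of_nat_le_iff Suc_le_eq)
    then have r: "real r + 1 \<le> 2 ^ (N\<^sub>1 + K)" by simp
    \<comment> \<open>A cell of length \<open>1 / 2 ^ N\<close> stretched by the slope
      \<open>2 powi k j\<close> has length \<open>1 / 2 ^ L\<close>.\<close>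
    define L where "L = nat (int N - k j)"
    have "N\<^sub>1 \<le> L" "int L = int N - k j"
      using K [OF j] by (auto simp: L_def N_def)
    then have slope: "2 powi k j = (2::real) ^ N / 2 ^ L"
      by (simp add: power_int_diff flip: power_int_of_nat)
    obtain A :: int where A: "?g j * 2 ^ L = of_int A"
      using N\<^sub>1 [OF \<open>N\<^sub>1 \<le> L\<close> j] by (metis Ints_cases)
    have f_eq: "f ((real i + x) / 2 ^ N) = (of_int (A + int r) + x) / 2 ^ L"
      if x: "x \<in> {0..1}" for x
    proof -
      have t: "(real i + x) / 2 ^ N = real j / 2 ^ N\<^sub>0 + (real r + x) / 2 ^ N"
        by (simp add: i_eq N_def power_add field_simps)
      have "(real r + x) / 2 ^ N \<le> 2 ^ (N\<^sub>1 + K) / 2 ^ N"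
        using r x by (intro divide_right_mono) auto
      also have "\<dots> = 1 / 2 ^ N\<^sub>0" by (simp add: N_def power_add)
      finally have "(real i + x) / 2 ^ N \<in> {real j / 2 ^ N\<^sub>0..real (Suc j) / 2 ^ N\<^sub>0}"
        unfolding t using x by (simp add: add_divide_distrib)
      then have "f ((real i + x) / 2 ^ N) = ?g j + 2 powi k j * ((real i + x) / 2 ^ N - real j / 2 ^ N\<^sub>0)"
        using pieces [OF j] by blast
      also have "\<dots> = ?g j + (real r + x) / 2 ^ L"
        by (simp add: t slope)
      also have "?g j = of_int A / 2 ^ L" by (simp flip: A)
      finally show ?thesis by (simp add: add_divide_distrib)
    qed
    have "real (Suc i) \<le> real (2 ^ N)" using i by (simp only: of_nat_le_iff Suc_le_eq)
    then have "(real i + 1) / 2 ^ N \<le> 1" by simp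
    moreover have "0 \<le> real i / 2 ^ N" "real i / 2 ^ N \<le> (real i + 1) / 2 ^ N"
      by (simp_all add: divide_right_mono)
    ultimately have "real i / 2 ^ N \<in> {0..1}" "(real i + 1) / 2 ^ N \<in> {0..1}"
      unfolding atLeastAtMost_iff by linarith+
    then have "f (real i / 2 ^ N) \<in> {0..1}" "f ((real i + 1) / 2 ^ N) \<in> {0..1}"
      using thompson_F_range [OF f] by blast+
    then have "0 \<le> real_of_int (A + int r) / 2 ^ L" "(real_of_int (A + int r) + 1) / 2 ^ L \<le> 1"
      using f_eq [of 0] f_eq [of 1] by auto
    then have "0 \<le> real_of_int (A + int r)" "real_of_int (A + int r + 1) \<le> real_of_int (2 ^ L)"
      by (simp_all add: pos_divide_le_eq pos_le_divide_eq del: of_int_0_le_iff)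
    \<comment> \<open>Since the image lies in the unit interval, the numerator of its left end is
      between 0 and \<open>2 ^ L - 1\<close>, hence has an \<open>L\<close>-digit binary
      expansion.\<close>
    then have B: "0 \<le> A + int r" "A + int r + 1 \<le> 2 ^ L"
      by (simp_all only: of_int_0_le_iff of_int_le_iff)
    then have "nat (A + int r) < 2 ^ L" by (simp add: nat_less_iff)
    then obtain w where w: "length w = L" "word_value w = real (nat (A + int r)) / 2 ^ L"
      using ex_word_value by blast
    have "f ((real i + x) / 2 ^ N) = word_value w + x / 2 ^ length w" if "x \<in> {0..1}" for x
      using f_eq [OF that] B(1) by (simp add: w add_divide_distrib del: of_int_add)
    then show ?thesis by blast
  qed
  then show ?thesis by blast
qed

lemma thompson_F_0: "f \<in> thompson_F \<Longrightarrow> f 0 = 0"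
  and thompson_F_1: "f \<in> thompson_F \<Longrightarrow> f 1 = 1"
  using thompson_F_affine_pieces [of f] thompson_F_grid(1,2) [of f] by metis+

text \<open>The domain tree is the complete tree of depth \<open>N\<close>. The image intervals
  again tile the unit interval from left to right, which yields the range tree.\<close>

lemma thompson_F_ex_represents:
  assumes f: "f \<in> thompson_F"
  shows "\<exists>T1 T2. represents T1 T2 f"
proof -
  obtain N w where w: "\<And>i x. i < 2 ^ N \<Longrightarrow> x \<in> {0..1} \<Longrightarrow>
      f ((real i + x) / 2 ^ N) = word_value (w i) + x / 2 ^ length (w i)"
    using thompson_F_cells [OF f] by metis
  obtain v where v: "\<And>i. i < 2 ^ N \<Longrightarrow> length (v i) = N \<and> word_value (v i) = real i / 2 ^ N"
    using ex_word_value [of _ N] by metis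
  let ?n = "2 ^ N :: nat"
  have "tiles (real 0 / 2 ^ N) (map v [0..<?n]) (real ?n / 2 ^ N)"
    using v by (intro tiles_map_upt) (auto simp: add_divide_distrib)
  then obtain T1 where T1: "leaves T1 = map v [0..<?n]"
    using tiles_imp_leaves by fastforce
  have "tiles (f (real 0 / 2 ^ N)) (map w [0..<?n]) (f (real ?n / 2 ^ N))"
  proof (rule tiles_map_upt)
    fix i assume "i < ?n"
    then show "word_value (w i) = f (real i / 2 ^ N) \<and>
        f (real i / 2 ^ N) + 1 / 2 ^ length (w i) = f (real (Suc i) / 2 ^ N)"
      using w [of i 0] w [of i 1] by (simp add: add.commute)
  qed simp
  then obtain T2 where T2: "leaves T2 = map w [0..<?n]"
    using tiles_imp_leaves thompson_F_0 [OF f] thompson_F_1 [OF f] by fastforce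
  have "represents T1 T2 f"
    unfolding represents_def
    using v w stream_value_bounds by (auto simp: T1 T2 stream_value_shift simp flip: add_divide_distrib)
  then show ?thesis by blast
qed

section \<open>Tree diagrams as affine maps and their slopes at the endpoints\<close>

lemma represents_affine:
  assumes "represents T1 T2 f" "k < length (leaves T1)" "x \<in> {0..1}"
  shows "f (word_value (leaves T1 ! k) + x / 2 ^ length (leaves T1 ! k)) =
    word_value (leaves T2 ! k) + x / 2 ^ length (leaves T2 ! k)"
proof -
  obtain s where "stream_value s = x" using ex_stream_value assms(3) by blast
  then show ?thesis using assms(1,2) by (auto simp: represents_def simp flip: stream_value_shift)
qed

lemma represents_word_value:
  assumes "represents T1 T2 f" "k < length (leaves T1)"
  shows "f (word_value (leaves T1 ! k @ u)) = word_value (leaves T2 ! k @ u)"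
  using represents_affine [OF assms, of "word_value u"] word_value_nonneg [of u] word_value_less_1 [of u]
  by (simp add: word_value_append)

text \<open>Both endpoints are limit points of the interval, so the one-sided derivative is unique
  and the existential in \<open>even_slope_at\<close> can only refer to the given one.\<close>

lemma even_slope_at_iff:
  assumes f: "(f has_real_derivative 2 powi m) (at x within {0..1})" and x: "x \<in> {0..1}"
  shows "even_slope_at f x \<longleftrightarrow> even m"
proof -
  have "at x within {0..1} \<noteq> bot"
    using x by (simp add: trivial_limit_within islimpt_Icc)
  then have "D = 2 powi m" if "(f has_real_derivative D) (at x within {0..1})" for D
    using that f has_field_derivative_unique by blast
  moreover have "log 2 (2 powi m) = of_int m" by (simp flip: powr_real_of_int')
  ultimately have "even_slope_at f x \<longleftrightarrow> (\<exists>l. real_of_int m = of_int (2 * l))"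
    unfolding even_slope_at_def using f by metis
  also have "\<dots> \<longleftrightarrow> even m" by (simp only: of_int_eq_iff) (auto elim: evenE)
  finally show ?thesis .
qed

lemma even_slope_at_0_iff:
  assumes "represents T1 T2 f"
    and a: "leaves T1 ! 0 = replicate a False" and b: "leaves T2 ! 0 = replicate b False"
  shows "even_slope_at f 0 \<longleftrightarrow> even a = even b"
proof -
  have f: "2 powi (int a - int b) * t = f t" if t: "t \<in> {0..1}" "dist t 0 < 1 / 2 ^ a" for t
  proof -
    have "t * 2 ^ a \<in> {0..1}" using t by (auto simp: field_simps)
    from represents_affine [OF assms(1) _ this, of 0] show ?thesis
      by (simp add: a b power_int_diff field_simps)
  qed
  have "(f has_real_derivative 2 powi (int a - int b)) (at 0 within {0..1})"
    by (rule has_field_derivative_transform_within [OF _ _ _ f])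
      (auto intro!: derivative_eq_intros)
  then show ?thesis by (subst even_slope_at_iff) auto
qed

text \<open>The last leaves have intervals ending at 1, so near 1 the map multiplies the distance to
  1 by the ratio of their lengths.\<close>

lemma even_slope_at_1_iff:
  assumes T: "represents T1 T2 f"
    and a: "leaves T1 ! (length (leaves T1) - 1) = replicate a True"
    and b: "leaves T2 ! (length (leaves T2) - 1) = replicate b True"
  shows "even_slope_at f 1 \<longleftrightarrow> even a = even b"
proof -
  have len: "length (leaves T2) = length (leaves T1)" using T by (simp add: represents_def)
  have f: "1 - 2 powi (int a - int b) * (1 - t) = f t" if t: "t \<in> {0..1}" "dist t 1 < 1 / 2 ^ a" for t
  proof -
    have "1 - (1 - t) * 2 ^ a \<in> {0..1}" using t by (auto simp: field_simps dist_real_def)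
    from represents_affine [OF T _ this, of "length (leaves T1) - 1"] show ?thesis
      using a b by (simp add: len word_value_replicate_True power_int_diff diff_divide_distrib mult.commute)
  qed
  have "(f has_real_derivative 2 powi (int a - int b)) (at 1 within {0..1})"
    by (rule has_field_derivative_transform_within [OF _ _ _ f])
      (auto intro!: derivative_eq_intros)
  then show ?thesis by (subst even_slope_at_iff) auto
qed

section \<open>Colorings\<close>

text \<open>The three elements of the color group sum to 0, which turns the description by exclusion
  into arithmetic.\<close>

lemma third_color_eq: "a \<noteq> b \<Longrightarrow> third_color a b = - a - b"
  unfolding third_color_def
proof (rule the_equality)
  show "- a - b \<noteq> a \<and> - a - b \<noteq> b" if "a \<noteq> b"
    using that exhaust_3 [of a] exhaust_3 [of b] by auto
  show "c = - a - b" if "a \<noteq> b" "c \<noteq> a \<and> c \<noteq> b" for c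
    using that exhaust_3 [of a] exhaust_3 [of b] exhaust_3 [of c] by auto
qed

lemma third_color_neq:
  assumes "a \<noteq> b"
  shows "third_color a b \<noteq> a" "third_color a b \<noteq> b"
  using assms exhaust_3 [of a] exhaust_3 [of b] by (auto simp: third_color_eq)

lemma third_color_unique: "a \<noteq> b \<Longrightarrow> c \<noteq> a \<Longrightarrow> c \<noteq> b \<Longrightarrow> third_color a b = c"
  using exhaust_3 [of a] exhaust_3 [of b] exhaust_3 [of c] by (auto simp: third_color_eq)

section \<open>Colors along words and weights of dyadic numbers\<close>

lemma color_pair_from_append:
  "color_pair_from a b (v @ w) =
    color_pair_from (fst (color_pair_from a b v)) (snd (color_pair_from a b v)) w"
  by (induction v arbitrary: a b) simp_all

lemma fst_color_pair_from_False [simp]: "fst (color_pair_from a b (replicate n False)) = a"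
  by (induction n arbitrary: b) simp_all

lemma color_pair_append:
  "v \<noteq> [] \<Longrightarrow> color_pair (v @ w) =
    color_pair_from (fst (color_pair v)) (snd (color_pair v)) w"
  by (cases v) (simp_all add: color_pair_from_append)

lemma weight_append: "v \<noteq> [] \<Longrightarrow>
    weight (v @ w) = fst (color_pair_from (fst (color_pair v)) (snd (color_pair v)) w)"
  by (simp add: weight_def color_pair_append)

lemma weight_padded [simp]: "weight (w @ replicate n False) = weight w"
proof (cases "w = []")
  case True
  then show ?thesis by (cases n) (simp_all add: weight_def)
next
  case False
  then show ?thesis by (simp add: weight_append) (simp add: weight_def)
qed

lemma weight_replicate_False [simp]: "weight (replicate n False) = 0"
  using weight_padded [of "[]" n] by (simp add: weight_def)

text \<open>Each step to the left keeps the left color and exchanges the two colors different from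
  it on the right.\<close>

lemma color_pair_from_replicate_False:
  "a \<noteq> b \<Longrightarrow> color_pair_from a b (replicate n False) = (a, if even n then b else third_color a b)"
proof (induction n arbitrary: b)
  case (Suc n)
  have "third_color a (third_color a b) = b"
    using Suc.prems third_color_neq [OF Suc.prems] by (intro third_color_unique) auto
  moreover have "a \<noteq> third_color a b" using third_color_neq [OF Suc.prems] by auto
  ultimately show ?case using Suc by simp
qed simp

lemma color_pair_from_replicate_True:
  "a \<noteq> b \<Longrightarrow> color_pair_from a b (replicate n True) = (if even n then a else third_color a b, b)"
proof (induction n arbitrary: a)
  case (Suc n)
  have "third_color (third_color a b) b = a"
    using Suc.prems third_color_neq [OF Suc.prems] by (intro third_color_unique) auto
  with Suc third_color_neq(2) [OF Suc.prems] show ?case by simp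
qed simp

lemma color_pair_replicate_False:
  "0 < n \<Longrightarrow> color_pair (replicate n False) = (0, if even n then 2 else 1)"
  by (cases n) (simp_all add: color_pair_from_replicate_False third_color_eq)

text \<open>The left color of the right child is the third color at its parent, so it reveals the
  right color of the parent and with it the parity of the depth.\<close>

lemma weight_replicate_False_True:
  "weight (replicate n False @ [True]) = (if even n then 1 else 2)"
  by (cases n) (simp_all add: weight_def color_pair_from_append color_pair_from_replicate_False third_color_eq)

lemma weight_replicate_True:
  "weight (replicate n True @ [True]) = (if even n then 1 else 2)"
  by (cases n) (simp_all add: weight_def color_pair_from_append color_pair_from_replicate_True third_color_eq)

text \<open>Two words of equal value become the same word once both are padded with zeros to a
  common length.\<close>

lemma dyadic_weight_word_value [simp]: "dyadic_weight (word_value w) = weight w"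
proof -
  have "weight v = weight w" if "word_value v = word_value w" for v
  proof -
    have "v @ replicate (length w) False = w @ replicate (length v) False"
      by (rule word_value_eqD) (simp_all add: word_value_append that)
    then show ?thesis by (metis weight_padded)
  qed
  then show ?thesis unfolding dyadic_weight_def by (intro the_equality) blast+
qed

lemma word_value_in_weight_class [simp]:
  "word_value w \<in> weight_class i \<longleftrightarrow> word_value w \<noteq> 0 \<and> weight w = i"
  using word_value_nonneg [of w] word_value_less_1 [of w] word_value_dyadic [of w]
  by (auto simp: weight_class_def)

section \<open>Colorings of the regions of a single tree\<close>

lemma Nil_in_vertices [simp]: "[] \<in> vertices T"
  by (simp add: vertices_def Bex_def ex_in_conv)

lemma vertices_Caret:
  "vertices (Caret l r) = {[]} \<union> Cons False ` vertices l \<union> Cons True ` vertices r"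
proof -
  have "v \<in> vertices (Caret l r) \<longleftrightarrow>
      v \<in> {[]} \<union> Cons False ` vertices l \<union> Cons True ` vertices r" for v
  proof (cases v)
    case Nil
    then show ?thesis by simp
  next
    case (Cons x v')
    then show ?thesis by (cases x) (auto simp: vertices_def bex_Un image_iff)
  qed
  then show ?thesis by blast
qed

lemma descendant_leaves_Nil [simp]: "descendant_leaves T [] = {1..length (leaves T)}"
  by (auto simp: descendant_leaves_def)

lemma descendant_leaves_False:
  "descendant_leaves (Caret l r) (False # v) = descendant_leaves l v"
proof (rule set_eqI)
  show "k \<in> descendant_leaves (Caret l r) (False # v) \<longleftrightarrow> k \<in> descendant_leaves l v" for k
    by (cases k) (auto simp: descendant_leaves_def nth_append)
qed

lemma descendant_leaves_True:
  "descendant_leaves (Caret l r) (True # v) = (+) (length (leaves l)) ` descendant_leaves r v"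
proof (rule set_eqI)
  fix k
  let ?n = "length (leaves l)"
  have "k \<in> descendant_leaves (Caret l r) (True # v) \<longleftrightarrow> ?n \<le> k \<and> k - ?n \<in> descendant_leaves r v"
    by (cases k) (auto simp: descendant_leaves_def nth_append Suc_diff_le)
  also have "\<dots> \<longleftrightarrow> k \<in> (+) ?n ` descendant_leaves r v"
  proof
    assume "?n \<le> k \<and> k - ?n \<in> descendant_leaves r v"
    then show "k \<in> (+) ?n ` descendant_leaves r v" by (intro image_eqI [of _ _ "k - ?n"]) auto
  qed auto
  finally show "k \<in> descendant_leaves (Caret l r) (True # v) \<longleftrightarrow> k \<in> (+) ?n ` descendant_leaves r v" .
qed

text \<open>Adds to \<open>separates_colors\<close> the edge above the root, which is present when \<open>T\<close> is a proper subtree.\<close>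

definition separates_all :: "bintree \<Rightarrow> (nat \<Rightarrow> 3) \<Rightarrow> bool" where
  "separates_all T c \<longleftrightarrow> c 0 \<noteq> c (length (leaves T)) \<and> separates_colors T c"

text \<open>All leaves descend from the root, so the edge above it separates the region 0 from the
  last one. Including it removes the exception for the root and makes the condition recursive over
  subtrees.\<close>

lemma separates_all_iff:
  "separates_all T c \<longleftrightarrow>
    (\<forall>v\<in>vertices T. \<forall>p q. p < q \<and> descendant_leaves T v = {p + 1..q} \<longrightarrow> c p \<noteq> c q)"
proof -
  define P where
    "P v \<longleftrightarrow> (\<forall>p q. p < q \<and> descendant_leaves T v = {p + 1..q} \<longrightarrow> c p \<noteq> c q)" for v
  have "p = 0 \<and> q = length (leaves T)" if "p < q" "descendant_leaves T [] = {p + 1..q}" for p q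
    using that by (simp add: Icc_eq_Icc)
  moreover have "0 < length (leaves T)" "descendant_leaves T [] = {0 + 1..length (leaves T)}"
    by (rule length_leaves_pos) simp
  ultimately have "P [] \<longleftrightarrow> c 0 \<noteq> c (length (leaves T))"
    unfolding P_def by metis
  then have "separates_all T c \<longleftrightarrow> P [] \<and> (\<forall>v\<in>vertices T. v \<noteq> [] \<longrightarrow> P v)"
    by (simp only: separates_all_def separates_colors_def P_def)
  also have "\<dots> \<longleftrightarrow> (\<forall>v\<in>vertices T. P v)"
    using Nil_in_vertices [of T] by auto
  finally show ?thesis unfolding P_def .
qed

lemma separates_colors_Caret:
  "separates_colors (Caret l r) c \<longleftrightarrow>
    separates_all l c \<and> separates_all r (\<lambda>k. c (length (leaves l) + k))"
proof -
  let ?n = "length (leaves l)"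
  \<comment> \<open>Leaves of the right subtree are renumbered by adding \<open>?n\<close>. Leaf
    numbers start at 1, so 0 is not in \<open>D\<close>, and this ensures that the lower region
    index \<open>p\<close> is at least \<open>?n\<close>.\<close>
  have shift: "(\<forall>p q. p < q \<and> (+) ?n ` D = {p + 1..q} \<longrightarrow> c p \<noteq> c q) \<longleftrightarrow>
      (\<forall>p q. p < q \<and> D = {p + 1..q} \<longrightarrow> c (?n + p) \<noteq> c (?n + q))" (is "?L \<longleftrightarrow> ?R")
    if "0 \<notin> D" for D
  proof
    assume ?L
    then show ?R by (auto simp: image_add_atLeastAtMost)
  next
    assume R: ?R
    show ?L
    proof (intro allI impI)
      fix p q assume pq: "p < q \<and> (+) ?n ` D = {p + 1..q}"
      then have "p + 1 \<in> (+) ?n ` D" by auto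
      then obtain d where "d \<in> D" "p + 1 = ?n + d" by auto
      with \<open>0 \<notin> D\<close> have "?n \<le> p" by (cases d) auto
      then obtain p' q' where p': "p = ?n + p'" "q = ?n + q'"
        using pq le_Suc_ex [of ?n p] le_Suc_ex [of ?n q] by auto
      then have "(+) ?n ` D = (+) ?n ` {p' + 1..q'}" using pq by simp
      then have "D = {p' + 1..q'}" by (rule inj_image_eq_iff [THEN iffD1, rotated]) simp
      then show "c p \<noteq> c q" using R pq p' by simp
    qed
  qed
  have "separates_colors (Caret l r) c \<longleftrightarrow>
     (\<forall>v\<in>vertices l. \<forall>p q. p < q \<and> descendant_leaves l v = {p + 1..q} \<longrightarrow> c p \<noteq> c q) \<and>
     (\<forall>v\<in>vertices r. \<forall>p q. p < q \<and> (+) ?n ` descendant_leaves r v = {p + 1..q} \<longrightarrow> c p \<noteq> c q)"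
    unfolding separates_colors_def vertices_Caret
    by (simp only: ball_Un ball_simps descendant_leaves_False descendant_leaves_True) simp
  moreover have "0 \<notin> descendant_leaves r v" for v by (simp add: descendant_leaves_def)
  ultimately show ?thesis by (simp only: shift separates_all_iff not_False_eq_True)
qed

lemma separates_colors_Tip [simp]: "separates_colors Tip c"
  by (simp add: separates_colors_def vertices_def)

lemma separates_all_Caret:
  "separates_all (Caret l r) c \<longleftrightarrow> c 0 \<noteq> c (length (leaves l) + length (leaves r)) \<and>
    separates_all l c \<and> separates_all r (\<lambda>k. c (length (leaves l) + k))"
  by (simp add: separates_all_def separates_colors_Caret)

text \<open>The region between the two subtrees borders the edges to both children, so its color
  must be the third one, exactly as in the recursion of \<open>color_pair_from\<close>.\<close>

lemma separates_all_imp_color_pair: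
  assumes "separates_all T c" "k < length (leaves T)"
  shows "color_pair_from (c 0) (c (length (leaves T))) (leaves T ! k) = (c k, c (Suc k))"
  using assms
proof (induction T arbitrary: c k)
  case (Caret l r)
  let ?n = "length (leaves l)"
  have l: "separates_all l c" and r: "separates_all r (\<lambda>k. c (?n + k))"
    and ne: "c 0 \<noteq> c (?n + length (leaves r))"
    using Caret.prems(1) by (auto simp: separates_all_Caret)
  have "third_color (c 0) (c (?n + length (leaves r))) = c ?n"
    using l r ne by (intro third_color_unique) (auto simp: separates_all_def)
  then show ?case
    using Caret.IH(1) [OF l, of k] Caret.IH(2) [OF r, of "k - ?n"] Caret.prems(2)
    by (auto simp: nth_append)
qed simp

lemma fst_color_pair_from_first_leaf:
  "fst (color_pair_from a b (leaves T ! 0)) = a"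
  using first_leaf [of T] by auto

text \<open>Left colors suffice: the right color of a leaf is the left color of the next leaf, or
  \<open>b\<close> at the end.\<close>

lemma color_pair_imp_separates_all:
  assumes "a \<noteq> b" "c (length (leaves T)) = b"
    and "\<And>k. k < length (leaves T) \<Longrightarrow> c k = fst (color_pair_from a b (leaves T ! k))"
  shows "separates_all T c"
  using assms
proof (induction T arbitrary: a b c)
  case Tip
  then show ?case by (simp add: separates_all_def)
next
  case (Caret l r)
  let ?n = "length (leaves l)" and ?m = "third_color a b"
  note ne = third_color_neq [OF Caret.prems(1)]
  have c0: "c 0 = a"
    using Caret.prems(3) [of 0] fst_color_pair_from_first_leaf [of a ?m l] by (simp add: nth_append)
  \<comment> \<open>Region \<open>?n\<close> lies to the left of the first leaf of \<open>r\<close>,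
    and a path of left turns keeps the left color.\<close>
  have cn: "c ?n = ?m"
    using Caret.prems(3) [of ?n] fst_color_pair_from_first_leaf [of ?m b r] by (simp add: nth_append)
  have "separates_all l c"
    using ne cn Caret.prems(3) by (intro Caret.IH(1) [of a ?m]) (auto simp: nth_append)
  moreover have "separates_all r (\<lambda>k. c (?n + k))"
    using ne Caret.prems(2,3) by (intro Caret.IH(2) [of ?m b]) (auto simp: nth_append)
  ultimately show ?case using Caret.prems(1,2) c0 by (auto simp: separates_all_Caret)
qed

text \<open>With the outer color fixed at 0, the color of the region below the root decides the
  whole coloring; the value 1 selects the coloring of the infinite tree.\<close>

lemma separates_colors_imp_color_pair:
  assumes "separates_colors (Caret l r) c" "k < length (leaves (Caret l r))"
    and "c 0 = 0" "c (length (leaves (Caret l r))) = 0" "c (length (leaves l)) = 1"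
  shows "color_pair (leaves (Caret l r) ! k) = (c k, c (Suc k))"
proof -
  let ?n = "length (leaves l)"
  have l: "separates_all l c" and r: "separates_all r (\<lambda>k. c (?n + k))"
    using assms(1) by (auto simp: separates_colors_Caret)
  show ?thesis
    using separates_all_imp_color_pair [OF l, of k] separates_all_imp_color_pair [OF r, of "k - ?n"] assms
    by (auto simp: nth_append)
qed

lemma separates_colors_weight:
  assumes "c (length (leaves T)) = 0"
    and "\<And>k. k < length (leaves T) \<Longrightarrow> c k = weight (leaves T ! k)"
  shows "separates_colors T c"
proof (cases T)
  case (Caret l r)
  let ?n = "length (leaves l)"
  have "c ?n = 1"
    using assms(2) [of ?n] fst_color_pair_from_first_leaf [of 1 0 r]
    by (simp add: Caret nth_append weight_def)
  then have "separates_all l c"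
    using assms(2) by (intro color_pair_imp_separates_all [of 0 1])
      (auto simp: Caret nth_append weight_def)
  moreover have "separates_all r (\<lambda>k. c (?n + k))"
    using assms by (intro color_pair_imp_separates_all [of 1 0])
      (auto simp: Caret nth_append weight_def)
  ultimately show ?thesis by (simp add: Caret separates_colors_Caret)
qed simp

lemma separates_colors_inj:
  "inj \<pi> \<Longrightarrow> separates_colors T c \<Longrightarrow> separates_colors T (\<lambda>k. \<pi> (c k))"
  by (simp add: separates_colors_def inj_eq)

lemma normalizing_color_permutation:
  fixes a b :: 3
  assumes "a \<noteq> b"
  shows "\<exists>\<pi>. inj \<pi> \<and> \<pi> a = 0 \<and> \<pi> b = (1::3)"
proof (intro exI conjI)
  \<comment> \<open>An affine map sending \<open>a\<close> to 0; the factor \<open>b - a\<close> is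
    1 or -1, hence its own inverse, so \<open>b\<close> goes to 1.\<close>
  let ?\<pi> = "\<lambda>x. (x - a) * (b - a)"
  have "b - a = 1 \<or> b - a = - 1"
    using assms exhaust_3 [of a] exhaust_3 [of b] by auto
  then show "inj ?\<pi>" and "?\<pi> b = 1" by (auto simp: inj_def)
qed simp

section \<open>Invariance of the weight classes and the two inclusions\<close>

lemma represents_word_value_eq_0_iff:
  assumes f: "f \<in> thompson_F" and T: "represents T1 T2 f" and k: "k < length (leaves T1)"
  shows "word_value (leaves T2 ! k @ u) = 0 \<longleftrightarrow> word_value (leaves T1 ! k @ u) = 0"
proof -
  let ?t = "word_value (leaves T1 ! k @ u)"
  have "f ?t = f 0 \<longleftrightarrow> ?t = 0"
    using word_value_nonneg less_imp_le [OF word_value_less_1]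
    by (intro inj_on_eq_iff [OF thompson_F_inj [OF f]]) auto
  then show ?thesis
    by (simp add: represents_word_value [OF T k] thompson_F_0 [OF f])
qed

text \<open>In either tree, every dyadic point of the half-open unit interval is a leaf followed by
  a finite word, so invariance can be tested on corresponding leaves.\<close>

lemma represents_image_eq:
  assumes T: "represents T1 T2 f" and Z: "Z \<subseteq> {0<..<1} \<inter> dyadic"
    and iff: "\<And>k u. k < length (leaves T1) \<Longrightarrow>
      word_value (leaves T1 ! k @ u) \<in> Z \<longleftrightarrow> word_value (leaves T2 ! k @ u) \<in> Z"
  shows "f ` Z = Z"
proof -
  have len: "length (leaves T2) = length (leaves T1)" using T by (simp add: represents_def)
  have leaf: "\<exists>k<length (leaves T). \<exists>u. t = word_value (leaves T ! k @ u)" if "t \<in> Z" for t T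
    using that Z by (intro dyadic_eq_leaf_value) auto
  show ?thesis
  proof (intro equalityI subsetI)
    fix y assume "y \<in> f ` Z"
    then obtain t where t: "t \<in> Z" "y = f t" by blast
    with leaf [of t T1] show "y \<in> Z" using iff represents_word_value [OF T] by metis
  next
    fix y assume y: "y \<in> Z"
    with leaf [of y T2] obtain k u where k: "k < length (leaves T1)" "y = word_value (leaves T2 ! k @ u)"
      unfolding len by blast
    then show "y \<in> f ` Z"
      using iff [OF k(1)] y represents_word_value [OF T k(1)] by (metis image_eqI)
  qed
qed

lemma planar_E_even_subset_Stab: "planar_E_even \<subseteq> Stab (weight_class i)"
proof
  fix f assume "f \<in> planar_E_even"
  then obtain T1 T2 c where f: "f \<in> thompson_F" and T: "represents T1 T2 f"
    and slope: "even_slope_at f 0"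
    and c: "c 0 = c (length (leaves T1))" "separates_colors T1 c" "separates_colors T2 c"
    by (auto simp: planar_E_even_def planar_E_def K22_def three_colorable_def)
  have len: "length (leaves T2) = length (leaves T1)" using T by (simp add: represents_def)
  have weight_eq: "weight (leaves T1 ! k @ u) = weight (leaves T2 ! k @ u)"
    if k: "k < length (leaves T1)" for k u
  \<comment> \<open>The trivial tree is separated because its only leaf is the root, which has the
    pair (0, 0) of equal colors.\<close>
  proof (cases T1)
    case Tip
    then have "T2 = Tip"
      using len length_leaves_eq_1_iff [of T2] by simp
    with Tip k show ?thesis by simp
  next
    case T1: (Caret l1 r1)
    have "T2 \<noteq> Tip"
      using len length_leaves_eq_1_iff [of T1] T1 by auto
    then obtain l2 r2 where T2: "T2 = Caret l2 r2" by (cases T2) auto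
    have "c 0 \<noteq> c (length (leaves l1))"
      using c(2) by (simp add: T1 separates_colors_Caret separates_all_def)
    then obtain \<pi> :: "3 \<Rightarrow> 3" where \<pi>: "inj \<pi>" "\<pi> (c 0) = 0" "\<pi> (c (length (leaves l1))) = 1"
      using normalizing_color_permutation by blast
    \<comment> \<open>Recoloring makes \<open>d\<close> the coloring of \<open>T1\<close> by its own
      weights. It remains to see that \<open>T2\<close> also carries its weight coloring and not the
      swapped one.\<close>
    define d where "d k = \<pi> (c k)" for k
    have d: "separates_colors T1 d" "separates_colors T2 d" "d 0 = 0" "d (length (leaves T1)) = 0"
      "d (length (leaves l1)) = 1"
      using c \<pi> separates_colors_inj unfolding d_def by auto
    have pair1: "color_pair (leaves T1 ! k) = (d k, d (Suc k))" if "k < length (leaves T1)" for k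
      using separates_colors_imp_color_pair [of l1 r1 d k] d that unfolding T1 by blast
    obtain a b where a: "leaves T1 ! 0 = replicate a False" and b: "leaves T2 ! 0 = replicate b False"
      using first_leaf by metis
    have "a > 0" "b > 0"
      using leaf_Nil_iff [of 0 T1] leaf_Nil_iff [of 0 T2] a b by (auto simp: T1 T2)
    moreover have "even a = even b"
      using even_slope_at_0_iff [OF T a b] slope by simp
    ultimately have pair_0: "color_pair (leaves T2 ! 0) = color_pair (leaves T1 ! 0)"
      by (simp add: a b color_pair_replicate_False)
    \<comment> \<open>Otherwise \<open>T2\<close> has its weight coloring after exchanging 1 and 2,
      which is negation. The first leaves have the same color pair by the parity of the slope, so
      \<open>d (Suc 0)\<close> equals its own negative and is 0; but the right color of
      \<open>replicate a False\<close> is 1 or 2.\<close>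
    have d_l2: "d (length (leaves l2)) = 1"
    proof (rule ccontr)
      assume "d (length (leaves l2)) \<noteq> 1"
      moreover have "d (length (leaves l2)) \<noteq> 0"
        using d(2,3) by (simp add: T2 separates_colors_Caret separates_all_def)
      ultimately have "- d (length (leaves l2)) = 1"
        using exhaust_3 [of "d (length (leaves l2))"] by auto
      moreover have "separates_colors T2 (\<lambda>k. - d k)"
        using separates_colors_inj [of uminus T2 d] d(2) by (simp add: inj_def)
      ultimately have "color_pair (leaves T2 ! 0) = (- d 0, - d (Suc 0))"
        using separates_colors_imp_color_pair [of l2 r2 "\<lambda>k. - d k" 0] d(3,4) len
        unfolding T2 by simp
      then have "- d (Suc 0) = d (Suc 0)"
        using pair_0 pair1 [of 0] by simp
      then have "d (Suc 0) = 0"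
        using exhaust_3 [of "d (Suc 0)"] by auto
      then show False
        using pair1 [of 0] color_pair_replicate_False [OF \<open>a > 0\<close>] by (simp add: a split: if_splits)
    qed
    have pair2: "color_pair (leaves T2 ! k) = (d k, d (Suc k))"
      using separates_colors_imp_color_pair [of l2 r2 d k] d d_l2 len k unfolding T2 by simp
    have "leaves T1 ! k \<noteq> []" "leaves T2 ! k \<noteq> []"
      using leaf_Nil_iff [of k T1] leaf_Nil_iff [of k T2] k len by (auto simp: T1 T2)
    then show ?thesis by (simp add: weight_append pair1 [OF k] pair2)
  qed
  have "f ` weight_class i = weight_class i"
    by (rule represents_image_eq [OF T])
      (auto simp: weight_eq represents_word_value_eq_0_iff [OF f T], auto simp: weight_class_def)
  then show "f \<in> Stab (weight_class i)"
    using f by (simp add: Stab_def)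
qed

lemma Stab_subset_planar_E_even: "(\<Inter>i. Stab (weight_class i)) \<subseteq> planar_E_even"
proof
  fix f assume stab: "f \<in> (\<Inter>i. Stab (weight_class i))"
  then have f: "f \<in> thompson_F" and image: "\<And>i. f ` weight_class i = weight_class i"
    by (auto simp: Stab_def)
  obtain T1 T2 where T: "represents T1 T2 f" using thompson_F_ex_represents [OF f] by blast
  have len: "length (leaves T2) = length (leaves T1)" using T by (simp add: represents_def)
  let ?n = "length (leaves T1)"
  \<comment> \<open>The value 0 is excluded since the weight classes contain only points of the open
    interval.\<close>
  have weight_eq: "weight (leaves T2 ! k @ u) = weight (leaves T1 ! k @ u)"
    if "k < ?n" "word_value (leaves T1 ! k @ u) \<noteq> 0" for k u
  proof -
    have "word_value (leaves T2 ! k @ u) \<in> f ` weight_class (weight (leaves T1 ! k @ u))"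
      using represents_word_value [OF T that(1), of u] that(2) by (metis image_eqI word_value_in_weight_class)
    then show ?thesis unfolding image by simp
  qed
  obtain a b where a: "leaves T1 ! 0 = replicate a False" and b: "leaves T2 ! 0 = replicate b False"
    using first_leaf by metis
  have "even a = even b"
    \<comment> \<open>Appending the digit 1 to the first leaf gives a nonzero point whose weight
      shows the parity of the depth.\<close>
    using weight_eq [of 0 "[True]"] a b
    by (auto simp: word_value_append weight_replicate_False_True split: if_splits)
  then have slope_0: "even_slope_at f 0" using even_slope_at_0_iff [OF T a b] by simp
  obtain a' b' where a': "leaves T1 ! (?n - 1) = replicate a' True"
    and b': "leaves T2 ! (length (leaves T2) - 1) = replicate b' True"
    using last_leaf by metis
  have "word_value (replicate a' True @ [True]) \<noteq> 0"
    using word_value_nonneg [of "replicate a' True"] by (simp add: word_value_append add_nonneg_eq_0_iff)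
  then have "even a' = even b'"
    using weight_eq [of "?n - 1" "[True]"] a' b' len
    by (auto simp: weight_replicate_True split: if_splits)
  then have slope_1: "even_slope_at f 1" using even_slope_at_1_iff [OF T a' b'] by simp
  \<comment> \<open>Region \<open>k\<close> lies to the left of the leaf with list index
    \<open>k\<close>; the default 0 colors the last region, which is the outer one and must agree
    with region 0.\<close>
  define c where "c k = (if k < ?n then weight (leaves T1 ! k) else 0)" for k
  have c_T2: "c k = weight (leaves T2 ! k)" if k: "k < ?n" for k
  \<comment> \<open>A leaf of value 0 is not covered by the invariance of the classes, but its image
    leaf also has value 0, and the weight depends only on the value.\<close>
  proof (cases "word_value (leaves T1 ! k) = 0")
    case True
    then have "word_value (leaves T2 ! k) = 0"
      using represents_word_value_eq_0_iff [OF f T k, of "[]"] by simp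
    with True have "weight (leaves T1 ! k) = weight (leaves T2 ! k)"
      by (metis dyadic_weight_word_value)
    then show ?thesis using k by (simp add: c_def)
  next
    case False
    then show ?thesis using weight_eq [OF k, of "[]"] k by (simp add: c_def)
  qed
  have "separates_colors T1 c" "separates_colors T2 c"
    using c_T2 len by (auto intro!: separates_colors_weight simp: c_def)
  moreover have "c 0 = c ?n"
    by (simp add: c_def a)
  ultimately have "three_colorable T1 T2" unfolding three_colorable_def by blast
  then show "f \<in> planar_E_even"
    using f T slope_0 slope_1 by (auto simp: planar_E_even_def planar_E_def K22_def)
qed

text \<open>A finite word never has value 1, so among values of words membership only means being
  nonzero, which corresponding leaves share.\<close>

lemma thompson_F_image_dyadic:
  assumes f: "f \<in> thompson_F"
  shows "f ` ({0<..<1} \<inter> dyadic) = {0<..<1} \<inter> dyadic"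
proof -
  obtain T1 T2 where T: "represents T1 T2 f" using thompson_F_ex_represents [OF f] by blast
  have "word_value w \<in> {0<..<1} \<inter> dyadic \<longleftrightarrow> word_value w \<noteq> 0" for w
    using word_value_nonneg [of w] word_value_less_1 [of w] word_value_dyadic [of w] by auto
  then show ?thesis
    by (intro represents_image_eq [OF T]) (simp_all add: represents_word_value_eq_0_iff [OF f T])
qed

theorem theorem3p5:
  fixes j :: 3
  shows "planar_E_even = (\<Inter>i. Stab (weight_class i)) \<and>
    (\<Inter>i. Stab (weight_class i)) = (\<Inter>i\<in>{i. i \<noteq> j}. Stab (weight_class i))"
proof
  show "planar_E_even = (\<Inter>i. Stab (weight_class i))"
    using planar_E_even_subset_Stab Stab_subset_planar_E_even by blast
  have "f \<in> Stab (weight_class j)" if f: "f \<in> (\<Inter>i\<in>{i. i \<noteq> j}. Stab (weight_class i))" for f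
  proof -
    let ?D = "{0<..<1} \<inter> dyadic"
    \<comment> \<open>The index \<open>j + 1\<close> differs from \<open>j\<close>, so at least one
      stabilizer is available to place \<open>f\<close> in F.\<close>
    have "f \<in> Stab (weight_class (j + 1))" using f by auto
    then have "f \<in> thompson_F" by (simp add: Stab_def)
    \<comment> \<open>The class \<open>j\<close> is the complement of the others among the dyadic
      points. An injective map that preserves both this set and the other classes preserves the
      complement.\<close>
    have "weight_class j = ?D - (\<Union>i\<in>{i. i \<noteq> j}. weight_class i)"
      by (auto simp: weight_class_def)
    moreover have "inj_on f ?D"
      by (rule inj_on_subset [OF thompson_F_inj [OF \<open>f \<in> thompson_F\<close>]]) auto
    then have "f ` (?D - (\<Union>i\<in>{i. i \<noteq> j}. weight_class i)) = f ` ?D - f ` (\<Union>i\<in>{i. i \<noteq> j}. weight_class i)"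
      by (rule inj_on_image_set_diff) (auto simp: weight_class_def)
    moreover have "f ` (\<Union>i\<in>{i. i \<noteq> j}. weight_class i) = (\<Union>i\<in>{i. i \<noteq> j}. weight_class i)"
      using f by (auto simp: Stab_def image_UN)
    ultimately show ?thesis
      using thompson_F_image_dyadic [OF \<open>f \<in> thompson_F\<close>] \<open>f \<in> thompson_F\<close> by (simp add: Stab_def)
  qed
  then show "(\<Inter>i. Stab (weight_class i)) = (\<Inter>i\<in>{i. i \<noteq> j}. Stab (weight_class i))" by blast
qed

end
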